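(* For $n \in \mathbb{N}$ let $NC^{\mathrm{(mton)}}_2(2n)$ carry the uniform distribution, and let $\mathrm{Int}_n, \mathrm{Out}_n : NC^{\mathrm{(mton)}}_2(2n) \to \mathbb{R}$ count, respectively, the interval pairs and the outer pairs of $\pi$ for $(\pi,u) \in NC^{\mathrm{(mton)}}_2(2n)$. Then: (1) $E[\mathrm{Int}_n] = (2n+1)/3$ for every $n \in \mathbb{N}$. (2) $E[\mathrm{Out}_n] = \frac{2^n \cdot n!}{(2n-1)!!} - 1$ for every $n \in \mathbb{N}$; consequently $E[\mathrm{Out}_n] \sim \sqrt{\pi n}$ as $n \to \infty$.
   Context: $NC_2(2n)$ is the set of non-crossing pair-partitions of $\{1,\ldots,2n\}$ (non-crossing partitions all of whose blocks have two elements). For blocks $V,W$, "$V$ nested inside $W$" means $\min V > \min W$ and $\max V < \max W$. A monotonic ordering of $\pi \in NC_2(2n)$ is a bijection $u : \pi \to \{1,\ldots,n\}$ with $u(V)>u(W)$ whenever $V$ is nested inside $W$. $NC^{\mathrm{(mton)}}_2(2n)$ is the set of pairs $(\pi,u)$ with $\pi\in NC_2(2n)$ and $u$ a monotonic ordering of $\pi$. A pair $V\in\pi$ is outer if it is nested inside no other pair of $\pi$; it is an interval pair if $V=\{m,m+1\}$ for some $1\le m\le 2n-1$. *)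

theory Defs
  imports "HOL-Probability.Probability"
begin

fun double_fact :: "nat \<Rightarrow> nat" where
  "double_fact 0 = 1"
| "double_fact (Suc 0) = 1"
| "double_fact (Suc (Suc n)) = Suc (Suc n) * double_fact n"

definition non_crossing :: "nat set set \<Rightarrow> bool" where
  "non_crossing P \<longleftrightarrow>
     \<not> (\<exists>V\<in>P. \<exists>W\<in>P. V \<noteq> W \<and>
          (\<exists>a b c d. a < b \<and> b < c \<and> c < d \<and> a \<in> V \<and> c \<in> V \<and> b \<in> W \<and> d \<in> W))"

definition NC2 :: "nat \<Rightarrow> nat set set set" where
  "NC2 m = {P. partition_on {1..m} P \<and> non_crossing P \<and> (\<forall>V\<in>P. card V = 2)}"

definition nested_inside :: "nat set \<Rightarrow> nat set \<Rightarrow> bool" where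
  "nested_inside V W \<longleftrightarrow> Min V > Min W \<and> Max V < Max W"

(* An ordering is a function on blocks only; membership in extensional P fixes its
   irrelevant values outside P, so that each ordering is counted exactly once. *)
definition monotonic_ordering :: "nat \<Rightarrow> nat set set \<Rightarrow> (nat set \<Rightarrow> nat) \<Rightarrow> bool" where
  "monotonic_ordering n P u \<longleftrightarrow>
     u \<in> extensional P \<and> bij_betw u P {1..n} \<and>
     (\<forall>V\<in>P. \<forall>W\<in>P. nested_inside V W \<longrightarrow> u V > u W)"

definition NC2_mton :: "nat \<Rightarrow> (nat set set \<times> (nat set \<Rightarrow> nat)) set" where
  "NC2_mton n = {(P, u). P \<in> NC2 (2 * n) \<and> monotonic_ordering n P u}"

definition interval_pair :: "nat \<Rightarrow> nat set \<Rightarrow> bool" where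
  "interval_pair n V \<longleftrightarrow> (\<exists>m. 1 \<le> m \<and> m \<le> 2 * n - 1 \<and> V = {m, m + 1})"

definition outer_pair :: "nat set set \<Rightarrow> nat set \<Rightarrow> bool" where
  "outer_pair P V \<longleftrightarrow> \<not> (\<exists>W\<in>P. nested_inside V W)"

definition Int_count :: "nat \<Rightarrow> nat set set \<times> (nat set \<Rightarrow> nat) \<Rightarrow> real" where
  "Int_count n = (\<lambda>(P, u). real (card {V \<in> P. interval_pair n V}))"

definition Out_count :: "nat set set \<times> (nat set \<Rightarrow> nat) \<Rightarrow> real" where
  "Out_count = (\<lambda>(P, u). real (card {V \<in> P. outer_pair P V}))"

lemma finite_NC2_mton: "finite (NC2_mton n)"
proof (rule finite_subset)
  show "NC2_mton n \<subseteq> (SIGMA P : Pow (Pow {1..2*n}). P \<rightarrow>\<^sub>E {1..n})"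
    by (auto simp: NC2_mton_def NC2_def monotonic_ordering_def partition_on_def PiE_def
        bij_betw_def)
  show "finite (SIGMA P : Pow (Pow {1..2*n}). P \<rightarrow>\<^sub>E {1..n})"
    by (intro finite_SigmaI finite_PiE) (auto intro: finite_subset)
qed

lemma NC2_mton_nonempty: "NC2_mton n \<noteq> {}"
proof -
  define B where "B = (\<lambda>k::nat. {2 * k - 1, 2 * k})"
  define P where "P = B ` {1..n}"
  define u where "u = restrict (\<lambda>V. Max V div 2) P"
  have Max_B: "Max (B k) = 2 * k" for k
    by (simp add: B_def)
  have Min_B: "Min (B k) = 2 * k - 1" for k
    by (simp add: B_def)
  have part: "partition_on {1..2*n} P"
  proof (rule partition_onI)
    show "\<Union>P = {1..2*n}"
    proof
      show "\<Union>P \<subseteq> {1..2*n}" by (auto simp: P_def B_def)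
      show "{1..2*n} \<subseteq> \<Union>P"
      proof
        fix x assume "x \<in> {1..2*n}"
        then have "x \<in> B ((x + 1) div 2)" "(x + 1) div 2 \<in> {1..n}"
          unfolding B_def by (simp, presburger, auto)
        then show "x \<in> \<Union>P" by (auto simp: P_def)
      qed
    qed
  next
    fix p q assume "p \<in> P" "q \<in> P" "p \<noteq> q"
    then obtain i j where ij: "p = B i" "q = B j" "i \<in> {1..n}" "j \<in> {1..n}"
      unfolding P_def by blast
    with \<open>p \<noteq> q\<close> have "i \<noteq> j" by blast
    with ij show "disjnt p q" by (auto simp: B_def disjnt_def; presburger)
  qed (auto simp: P_def B_def)
  have "non_crossing P"
    by (auto simp: non_crossing_def P_def B_def)
  moreover have "\<forall>V\<in>P. card V = 2"
    by (auto simp: P_def B_def)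
  moreover have "bij_betw u P {1..n}"
    by (rule bij_betwI[where g = B]) (auto simp: u_def P_def Max_B)
  moreover have "\<not> nested_inside V W" if "V \<in> P" "W \<in> P" for V W
    using that by (auto simp: nested_inside_def P_def Max_B Min_B)
  ultimately have "(P, u) \<in> NC2_mton n"
    using part by (auto simp: NC2_mton_def NC2_def monotonic_ordering_def u_def)
  then show ?thesis by blast
qed

(* The two preceding facts make pmf_of_set the uniform distribution here. *)
definition mton_pmf :: "nat \<Rightarrow> (nat set set \<times> (nat set \<Rightarrow> nat)) pmf" where
  "mton_pmf n = pmf_of_set (NC2_mton n)"

end

theory Submission
  imports Defs "HOL-Real_Asymp.Real_Asymp"
begin

text \<open>
  In a monotonically ordered pair-partition of \<open>2n + 2\<close> points the pair with the largest label
  contains no other pair, so it is an interval \<open>{m, m + 1}\<close>. Deleting it gives a bijection onto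
  the monotonically ordered pair-partitions of \<open>2n\<close> points together with a gap among the
  \<open>2n + 1\<close> possible ones. The new interval pair destroys an old one only when it is put in the
  middle of it, and it is outer iff its gap is the leftmost one or immediately follows an outer
  pair. Averaging over the gaps yields
  \<open>(2n + 1) E[Int_(n+1)] = 2n E[Int_n] + 2n + 1\<close> and
  \<open>(2n + 1) E[Out_(n+1)] = (2n + 2) E[Out_n] + 1\<close>. The square of
  \<open>2^n n! / (2n - 1)!!\<close> is \<open>2n + 1\<close> times the partial Wallis product.
\<close>

section \<open>Inserting an interval pair at a gap\<close>

text \<open>Relabels the old points to make room for a new pair at \<open>m\<close> and
  \<open>Suc m\<close>. Gap \<open>m\<close> thus lies just before the old point
  \<open>m\<close>.\<close>

definition skip_pair :: "nat \<Rightarrow> nat \<Rightarrow> nat" where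
  "skip_pair m x = (if x < m then x else x + 2)"

definition insert_pair :: "nat \<Rightarrow> nat set set \<Rightarrow> nat set set" where
  "insert_pair m P = insert {m, Suc m} ((`) (skip_pair m) ` P)"

text \<open>Taking preimages under \<open>skip_pair m\<close> recovers the old block. The
  restriction makes the result extensional, so equal orderings are equal functions.\<close>

definition insert_ordering ::
    "nat \<Rightarrow> nat \<Rightarrow> nat set set \<Rightarrow> (nat set \<Rightarrow> nat) \<Rightarrow> nat set \<Rightarrow> nat" where
  "insert_ordering n m P u =
     (\<lambda>V\<in>insert_pair m P. if V = {m, Suc m} then Suc n else u (skip_pair m -` V))"

lemma strict_mono_skip_pair: "strict_mono (skip_pair m)"
  by (auto simp: strict_mono_def skip_pair_def)

lemma inj_skip_pair: "inj (skip_pair m)"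
  using strict_mono_skip_pair by (rule strict_mono_imp_inj_on)

lemma skip_pair_less_iff [simp]: "skip_pair m x < skip_pair m y \<longleftrightarrow> x < y"
  by (simp add: strict_mono_less strict_mono_skip_pair)

lemma image_skip_pair_eq_iff [simp]: "skip_pair m ` V = skip_pair m ` W \<longleftrightarrow> V = W"
  by (simp add: inj_image_eq_iff inj_skip_pair)

lemma vimage_skip_pair_image [simp]: "skip_pair m -` skip_pair m ` V = V"
  by (simp add: inj_vimage_image_eq inj_skip_pair)

lemma skip_pair_neq [simp]:
  "skip_pair m x \<noteq> m" "skip_pair m x \<noteq> Suc m" "m \<noteq> skip_pair m x" "Suc m \<noteq> skip_pair m x"
  by (auto simp: skip_pair_def)

lemma image_skip_pair_neq [simp]:
  "skip_pair m ` V \<noteq> {m, Suc m}" "{m, Suc m} \<noteq> skip_pair m ` V"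
  by (metis imageE insertI1 skip_pair_neq(1))+

lemma range_skip_pair: "range (skip_pair m) = - {m, Suc m}"
proof -
  have "y \<in> range (skip_pair m)" if "y \<noteq> m" "y \<noteq> Suc m" for y
  proof (cases "y < m")
    case True
    then show ?thesis by (intro range_eqI[of _ _ y]) (simp add: skip_pair_def)
  next
    case False
    with that have "m \<le> y - 2" "y = y - 2 + 2" by arith+
    then show ?thesis by (intro range_eqI[of _ _ "y - 2"]) (simp add: skip_pair_def)
  qed
  then show ?thesis by auto
qed

lemma image_skip_pair_atLeastAtMost:
  assumes "m \<in> {1..2*n+1}"
  shows "skip_pair m ` {1..2*n} = {1..2 * Suc n} - {m, Suc m}"
proof
  show "skip_pair m ` {1..2*n} \<subseteq> {1..2 * Suc n} - {m, Suc m}"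
    by (auto simp: skip_pair_def)
  show "{1..2 * Suc n} - {m, Suc m} \<subseteq> skip_pair m ` {1..2*n}"
  proof
    fix y assume y: "y \<in> {1..2 * Suc n} - {m, Suc m}"
    then obtain x where x: "y = skip_pair m x"
      using range_skip_pair[of m] by blast
    with y assms have "x \<in> {1..2*n}"
      by (auto simp: skip_pair_def split: if_splits)
    with x show "y \<in> skip_pair m ` {1..2*n}" by blast
  qed
qed

lemma Min_image_skip_pair:
  "finite V \<Longrightarrow> V \<noteq> {} \<Longrightarrow> Min (skip_pair m ` V) = skip_pair m (Min V)"
  by (simp add: mono_Min_commute strict_mono_mono strict_mono_skip_pair)

lemma Max_image_skip_pair:
  "finite V \<Longrightarrow> V \<noteq> {} \<Longrightarrow> Max (skip_pair m ` V) = skip_pair m (Max V)"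
  by (simp add: mono_Max_commute strict_mono_mono strict_mono_skip_pair)

lemma partition_on_inj_image_iff:
  assumes "inj f"
  shows "partition_on (f ` A) ((`) f ` P) \<longleftrightarrow> partition_on A P"
proof -
  have "disjoint ((`) f ` P) \<longleftrightarrow> disjoint P"
    using assms by (simp add: pairwise_image pairwise_def disjnt_def inj_image_eq_iff
        flip: image_Int)
  moreover have "f ` A = \<Union>((`) f ` P) \<longleftrightarrow> A = \<Union>P"
    using assms by (simp add: inj_image_eq_iff flip: image_Union)
  moreover have "{} \<notin> (`) f ` P \<longleftrightarrow> {} \<notin> P"
    by auto
  ultimately show ?thesis
    unfolding partition_on_def by metis
qed

text \<open>No number lies strictly between \<open>m\<close> and \<open>Suc m\<close>, so the new
  pair crosses nothing; a strictly increasing relabelling preserves and reflects the crossings of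
  the others.\<close>

lemma non_crossing_insert_pair: "non_crossing (insert_pair m P) \<longleftrightarrow> non_crossing P"
proof -
  define cr where "cr = (\<lambda>V W. \<exists>a\<in>V. \<exists>c\<in>V. \<exists>b\<in>W. \<exists>d\<in>W.
    a < b \<and> b < c \<and> c < (d :: nat))"
  have nc: "non_crossing Q \<longleftrightarrow> (\<forall>V\<in>Q. \<forall>W\<in>Q. V \<noteq> W \<longrightarrow> \<not> cr V W)" for Q
    unfolding non_crossing_def cr_def by blast
  have "cr (skip_pair m ` V) (skip_pair m ` W) \<longleftrightarrow> cr V W" for V W
    unfolding cr_def by simp
  moreover have "\<not> cr {m, Suc m} W" "\<not> cr W {m, Suc m}" for W
    unfolding cr_def by auto
  ultimately show ?thesis
    unfolding nc insert_pair_def by simp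
qed

text \<open>Read from right to left this serves insertion, from left to right it serves
  deletion.\<close>

lemma NC2_insert_pair:
  assumes "m \<in> {1..2*n+1}"
  shows "insert_pair m P \<in> NC2 (2 * Suc n) \<longleftrightarrow> P \<in> NC2 (2 * n)"
proof -
  have "disjnt {m, Suc m} (\<Union>((`) (skip_pair m) ` P))"
    by (auto simp: disjnt_def)
  then have "partition_on {1..2 * Suc n} (insert_pair m P) \<longleftrightarrow>
      partition_on (skip_pair m ` {1..2*n}) ((`) (skip_pair m) ` P)"
    using assms unfolding insert_pair_def image_skip_pair_atLeastAtMost[OF assms]
    by (subst partition_on_insert) auto
  also have "\<dots> \<longleftrightarrow> partition_on {1..2*n} P"
    by (rule partition_on_inj_image_iff[OF inj_skip_pair])
  finally have "partition_on {1..2 * Suc n} (insert_pair m P) \<longleftrightarrow> partition_on {1..2*n} P" .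
  moreover have "(\<forall>V\<in>insert_pair m P. card V = 2) \<longleftrightarrow> (\<forall>V\<in>P. card V = 2)"
    by (simp add: insert_pair_def card_image inj_on_subset[OF inj_skip_pair])
  ultimately show ?thesis
    by (simp add: NC2_def non_crossing_insert_pair)
qed

section \<open>Blocks of non-crossing pair-partitions\<close>

lemma NC2_block:
  assumes "P \<in> NC2 k" "V \<in> P"
  shows "finite V" "V \<noteq> {}" "V = {Min V, Max V}" "Min V < Max V" "V \<subseteq> {1..k}"
proof -
  have c: "card V = 2" using assms by (auto simp: NC2_def)
  then obtain a b where ab: "V = {a, b}" "a < b"
    by (metis card_2_iff insert_commute nat_neq_iff)
  then show "finite V" "V \<noteq> {}" "V = {Min V, Max V}" "Min V < Max V"
    by auto
  show "V \<subseteq> {1..k}"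
    using assms by (auto simp: NC2_def partition_on_def)
qed

lemma NC2_disjoint:
  assumes "P \<in> NC2 k" "V \<in> P" "W \<in> P" "x \<in> V" "x \<in> W"
  shows "V = W"
  using assms unfolding NC2_def partition_on_def disjoint_def by blast

lemma NC2_finite: "P \<in> NC2 k \<Longrightarrow> finite P"
  by (auto simp: NC2_def intro: finite_elements)

text \<open>Otherwise the four endpoints form the forbidden pattern; equal maxima are excluded by
  disjointness.\<close>

lemma NC2_not_crossing:
  assumes "P \<in> NC2 k" "V \<in> P" "W \<in> P" "V \<noteq> W" "Min V < Min W" "Min W < Max V"
  shows "Max W < Max V"
proof (rule ccontr)
  assume "\<not> Max W < Max V"
  moreover have "Max V \<noteq> Max W"
    using NC2_disjoint[OF assms(1-3), of "Max V"] NC2_block(1,2)[OF assms(1)] assms(2-4)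
    by (metis Max_in)
  ultimately have "Max V < Max W" by simp
  moreover have "Min V \<in> V" "Max V \<in> V" "Min W \<in> W" "Max W \<in> W"
    using NC2_block(1,2)[OF assms(1)] assms(2,3) by auto
  ultimately show False
    using assms unfolding NC2_def non_crossing_def by blast
qed

section \<open>Nesting and monotonic orderings under insertion\<close>

lemma nested_inside_skip_pair:
  assumes "P \<in> NC2 k" "V \<in> P" "W \<in> P"
  shows "nested_inside (skip_pair m ` V) (skip_pair m ` W) \<longleftrightarrow> nested_inside V W"
  using NC2_block(1,2)[OF assms(1)] assms(2,3)
  by (simp add: nested_inside_def Min_image_skip_pair Max_image_skip_pair)

text \<open>One bound is strict and the other is not because the old point \<open>m\<close> moves to
  the right of the new pair: a block ending there encloses the pair, a block starting there does
  not.\<close>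

lemma nested_inside_inserted:
  assumes "P \<in> NC2 k" "W \<in> P"
  shows "nested_inside {m, Suc m} (skip_pair m ` W) \<longleftrightarrow> Min W < m \<and> m \<le> Max W"
    "\<not> nested_inside (skip_pair m ` W) {m, Suc m}"
  using NC2_block(4)[OF assms]
  unfolding nested_inside_def Min_image_skip_pair[OF NC2_block(1,2)[OF assms]]
    Max_image_skip_pair[OF NC2_block(1,2)[OF assms]]
  by (auto simp: skip_pair_def)

text \<open>Nothing is nested inside the new pair, and every block around it has a label at most
  \<open>n\<close>, so giving it the top label meets all the order conditions that involve
  it.\<close>

lemma monotonic_ordering_insert_pair_iff:
  assumes P: "P \<in> NC2 k" and u: "u' {m, Suc m} = Suc n"
  shows "monotonic_ordering (Suc n) (insert_pair m P) u' \<longleftrightarrow>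
    u' \<in> extensional (insert_pair m P) \<and>
    monotonic_ordering n P (\<lambda>V\<in>P. u' (skip_pair m ` V))"
    (is "_ \<longleftrightarrow> _ \<and> monotonic_ordering n P ?u")
proof -
  let ?Q = "(`) (skip_pair m) ` P"
  have "bij_betw u' (insert_pair m P) {1..Suc n} \<longleftrightarrow> bij_betw u' ?Q {1..n}"
    unfolding insert_pair_def
    by (subst notIn_Un_bij_betw3[of "{m, Suc m}" ?Q u' "{1..n}"])
       (use u in \<open>auto simp: atLeastAtMostSuc_conv\<close>)
  also have "\<dots> \<longleftrightarrow> bij_betw (u' \<circ> (`) (skip_pair m)) P {1..n}"
    by (rule bij_betw_comp_iff) (simp add: bij_betw_def inj_on_def)
  also have "\<dots> \<longleftrightarrow> bij_betw ?u P {1..n}"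
    by (rule bij_betw_cong) simp
  finally have bij: "bij_betw u' (insert_pair m P) {1..Suc n} \<longleftrightarrow> bij_betw ?u P {1..n}" .
  \<comment> \<open>Bijectivity is assumed here because it bounds the old labels by
    \<open>n\<close>, below the label of the new pair.\<close>
  have "(\<forall>V\<in>insert_pair m P. \<forall>W\<in>insert_pair m P. nested_inside V W \<longrightarrow> u' V > u' W) \<longleftrightarrow>
      (\<forall>V\<in>P. \<forall>W\<in>P. nested_inside V W \<longrightarrow> ?u V > ?u W)"
    if b: "bij_betw ?u P {1..n}"
  proof -
    have "u' (skip_pair m ` V) \<le> n" if "V \<in> P" for V
      using bij_betwE[OF b] that by fastforce
    then show ?thesis
      using u nested_inside_inserted(2)[OF P]
      by (simp add: insert_pair_def nested_inside_skip_pair[OF P] less_Suc_eq_le)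
         (simp add: nested_inside_def)
  qed
  then show ?thesis
    unfolding monotonic_ordering_def using bij by auto
qed

lemma insert_ordering_inserted [simp]: "insert_ordering n m P u {m, Suc m} = Suc n"
  by (simp add: insert_ordering_def insert_pair_def)

lemma insert_ordering_extensional: "insert_ordering n m P u \<in> extensional (insert_pair m P)"
  by (simp add: insert_ordering_def)

text \<open>Together with \<open>insert_ordering_restrict\<close> this makes insertion and deletion
  of the top label mutually inverse.\<close>

lemma restrict_insert_ordering:
  "u \<in> extensional P \<Longrightarrow> (\<lambda>V\<in>P. insert_ordering n m P u (skip_pair m ` V)) = u"
  by (auto simp: insert_ordering_def insert_pair_def restrict_def extensional_def fun_eq_iff)

lemma insert_ordering_restrict:
  assumes "u' \<in> extensional (insert_pair m P)" "u' {m, Suc m} = Suc n"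
  shows "insert_ordering n m P (\<lambda>V\<in>P. u' (skip_pair m ` V)) = u'"
proof
  fix V show "insert_ordering n m P (\<lambda>V\<in>P. u' (skip_pair m ` V)) V = u' V"
  proof (cases "V \<in> insert_pair m P")
    case True
    then consider "V = {m, Suc m}" | W where "W \<in> P" "V = skip_pair m ` W"
      by (auto simp: insert_pair_def)
    then show ?thesis
    proof cases
      case 1
      then show ?thesis using assms(2) by simp
    next
      case 2
      then show ?thesis by (simp add: insert_ordering_def insert_pair_def)
    qed
  next
    case False
    then show ?thesis using assms(1) by (simp add: insert_ordering_def extensional_def)
  qed
qed

lemma monotonic_ordering_insert_ordering:
  assumes "P \<in> NC2 k" "monotonic_ordering n P u"
  shows "monotonic_ordering (Suc n) (insert_pair m P) (insert_ordering n m P u)"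
proof -
  have "u \<in> extensional P" using assms(2) by (simp add: monotonic_ordering_def)
  then show ?thesis
    using assms(2)
    by (simp add: monotonic_ordering_insert_pair_iff[OF assms(1)] insert_ordering_extensional
        restrict_insert_ordering)
qed

section \<open>Deleting the pair with the largest label\<close>

text \<open>If the top block were not an interval, the block through the point after its minimum
  would be nested inside it and would need a still larger label.\<close>

lemma NC2_last_is_interval:
  assumes P: "P \<in> NC2 (2 * Suc n)" and u: "monotonic_ordering (Suc n) P u"
  obtains m where "m \<in> {1..2*n+1}" "{m, Suc m} \<in> P" "u {m, Suc m} = Suc n"
proof -
  have bij: "bij_betw u P {1..Suc n}"
    using u by (simp add: monotonic_ordering_def)
  then obtain V where V: "V \<in> P" "u V = Suc n"
    by (metis atLeastAtMost_iff bij_betw_iff_bijections le_refl le_add1 plus_1_eq_Suc)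
  note blk = NC2_block[OF P]
  have "Max V = Suc (Min V)"
  proof (rule ccontr)
    assume ne: "Max V \<noteq> Suc (Min V)"
    then have lt: "Suc (Min V) < Max V"
      using blk(4)[OF V(1)] by simp
    have "Suc (Min V) \<in> \<Union>P"
      using P lt blk(5)[OF V(1)] blk(1,2)[OF V(1)] unfolding NC2_def partition_on_def
      by (smt (verit) Max_in atLeastAtMost_iff le_SucI less_imp_le mem_Collect_eq order_trans
          subset_iff le_add1 plus_1_eq_Suc)
    then obtain W where W: "W \<in> P" "Suc (Min V) \<in> W" by blast
    have "Suc (Min V) \<notin> V"
      using ne blk(3)[OF V(1)] by (metis insertE n_not_Suc_n singletonD)
    with W have VW: "V \<noteq> W" by blast
    have "W = {Min W, Max W}" by (rule blk(3)[OF W(1)])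
    \<comment> \<open>In the first case \<open>W\<close> starts inside \<open>V\<close> and so ends
      inside it. The second case is impossible, since \<open>W\<close> would start before
      \<open>V\<close> and cross it.\<close>
    with W(2) have "Min W = Suc (Min V) \<or> Max W = Suc (Min V)"
      by (metis insertE singletonD)
    moreover have "Min V \<noteq> Min W"
      using NC2_disjoint[OF P V(1) W(1)] VW blk(1,2)[OF V(1)] blk(1,2)[OF W(1)]
      by (metis Min_in)
    moreover have "Max V \<noteq> Max W"
      using NC2_disjoint[OF P V(1) W(1)] VW blk(1,2)[OF V(1)] blk(1,2)[OF W(1)]
      by (metis Max_in)
    moreover have "Min V \<noteq> Max W"
      using NC2_disjoint[OF P V(1) W(1)] VW blk(1,2)[OF V(1)] blk(1,2)[OF W(1)]
      by (metis Max_in Min_in)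
    ultimately have "nested_inside W V"
      using NC2_not_crossing[OF P V(1) W(1) VW] NC2_not_crossing[OF P W(1) V(1) VW[symmetric]]
        blk(4)[OF V(1)] blk(4)[OF W(1)] lt
      unfolding nested_inside_def by linarith
    then have "u W > Suc n"
      using u V W(1) unfolding monotonic_ordering_def by metis
    then show False
      using bij_betwE[OF bij] W(1) by fastforce
  qed
  then have Veq: "V = {Min V, Suc (Min V)}"
    using blk(3)[OF V(1)] by metis
  have "Min V \<in> {1..2*n+1}"
    using blk(5)[OF V(1)] by (subst (asm) Veq) auto
  then show ?thesis
    using that[of "Min V"] V Veq by metis
qed

text \<open>Disjointness keeps every other block away from \<open>m\<close> and
  \<open>Suc m\<close>, hence within the range of \<open>skip_pair m\<close>, so preimages lose no
  points.\<close>

lemma insert_pair_vimage: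
  assumes P: "P \<in> NC2 k" and m: "{m, Suc m} \<in> P"
  shows "insert_pair m ((-`) (skip_pair m) ` (P - {{m, Suc m}})) = P"
proof -
  have "skip_pair m ` skip_pair m -` V = V" if "V \<in> P" "V \<noteq> {m, Suc m}" for V
    using NC2_disjoint[OF P that(1) m] that(2) by (auto simp: image_vimage_eq range_skip_pair)
  then have "(`) (skip_pair m) ` (-`) (skip_pair m) ` (P - {{m, Suc m}}) = P - {{m, Suc m}}"
    by (auto simp: image_image)
  with m show ?thesis
    by (auto simp: insert_pair_def)
qed

text \<open>The new pair is recognisable as the block labelled \<open>Suc n\<close>. This determines
  the gap, and then the old partition and ordering; surjectivity is deletion of that block.\<close>

lemma bij_betw_insert_pair:
  "bij_betw (\<lambda>((P, u), m). (insert_pair m P, insert_ordering n m P u))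
     (NC2_mton n \<times> {1..2*n+1}) (NC2_mton (Suc n))"
  unfolding bij_betw_def
proof
  show "inj_on (\<lambda>((P, u), m). (insert_pair m P, insert_ordering n m P u)) (NC2_mton n \<times> {1..2*n+1})"
  proof (rule inj_onI)
    fix x x' assume x: "x \<in> NC2_mton n \<times> {1..2*n+1}" "x' \<in> NC2_mton n \<times> {1..2*n+1}"
      and eqx: "(\<lambda>((P, u), m). (insert_pair m P, insert_ordering n m P u)) x =
        (\<lambda>((P, u), m). (insert_pair m P, insert_ordering n m P u)) x'"
    obtain P u m P' u' m' where xx: "x = ((P, u), m)" "x' = ((P', u'), m')"
      by (metis surj_pair)
    with x have 1: "(P, u) \<in> NC2_mton n" "m \<in> {1..2*n+1}"
      and 2: "(P', u') \<in> NC2_mton n" "m' \<in> {1..2*n+1}"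
      by auto
    have eq: "insert_pair m P = insert_pair m' P'"
      "insert_ordering n m P u = insert_ordering n m' P' u'"
      using eqx unfolding xx by simp_all
    have ext: "u \<in> extensional P" "u' \<in> extensional P'"
      using 1 2 by (auto simp: NC2_mton_def monotonic_ordering_def)
    have "bij_betw (insert_ordering n m P u) (insert_pair m P) {1..Suc n}"
      using 1 monotonic_ordering_insert_ordering[of P "2*n" n u m]
      by (simp add: NC2_mton_def monotonic_ordering_def)
    then have "inj_on (insert_ordering n m P u) (insert_pair m P)"
      by (simp add: bij_betw_def)
    moreover have "insert_ordering n m P u {m, Suc m} = insert_ordering n m P u {m', Suc m'}"
      by (simp add: eq(2)) (simp flip: eq(2))
    moreover have "{m, Suc m} \<in> insert_pair m P" "{m', Suc m'} \<in> insert_pair m P"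
      by (simp add: insert_pair_def) (simp add: eq(1), simp add: insert_pair_def)
    ultimately have "{m, Suc m} = {m', Suc m'}"
      by (rule inj_onD)
    then have m: "m' = m" by (auto simp: doubleton_eq_iff)
    have "(`) (skip_pair m) ` P = (`) (skip_pair m) ` P'"
      using eq(1) unfolding m insert_pair_def by (subst (asm) insert_ident) auto
    then have "P = P'"
      using inj_image_eq_iff[of "(`) (skip_pair m)"] by (simp add: inj_def)
    moreover from this have "u = u'"
      using eq(2) m restrict_insert_ordering ext by metis
    ultimately show "x = x'"
      using m xx by simp
  qed
  show "(\<lambda>((P, u), m). (insert_pair m P, insert_ordering n m P u)) ` (NC2_mton n \<times> {1..2*n+1})
      = NC2_mton (Suc n)" (is "?f ` _ = _")
  proof
    show "?f ` (NC2_mton n \<times> {1..2*n+1}) \<subseteq> NC2_mton (Suc n)"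
    proof (rule image_subsetI)
      fix x assume "x \<in> NC2_mton n \<times> {1..2*n+1}"
      then obtain P u m where "x = ((P, u), m)" "(P, u) \<in> NC2_mton n" "m \<in> {1..2*n+1}"
        by (metis SigmaE surj_pair)
      then show "?f x \<in> NC2_mton (Suc n)"
        using monotonic_ordering_insert_ordering[of P "2*n" n u m] NC2_insert_pair[of m n P]
        by (simp add: NC2_mton_def)
    qed
    show "NC2_mton (Suc n) \<subseteq> ?f ` (NC2_mton n \<times> {1..2*n+1})"
    proof (rule subrelI)
      fix P' u' assume "(P', u') \<in> NC2_mton (Suc n)"
      then have P': "P' \<in> NC2 (2 * Suc n)" and u': "monotonic_ordering (Suc n) P' u'"
        by (auto simp: NC2_mton_def)
      obtain m where m: "m \<in> {1..2*n+1}" "{m, Suc m} \<in> P'" "u' {m, Suc m} = Suc n"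
        using NC2_last_is_interval[OF P' u'] .
      define P where "P = (-`) (skip_pair m) ` (P' - {{m, Suc m}})"
      define u where "u = (\<lambda>V\<in>P. u' (skip_pair m ` V))"
      have Peq: "insert_pair m P = P'"
        unfolding P_def by (rule insert_pair_vimage[OF P' m(2)])
      then have P: "P \<in> NC2 (2 * n)"
        using NC2_insert_pair[OF m(1)] P' by blast
      have "u' \<in> extensional (insert_pair m P)" "monotonic_ordering n P u"
        using monotonic_ordering_insert_pair_iff[of P "2*n" u' m n] P m(3) u'
        unfolding u_def Peq by auto
      with insert_ordering_restrict[OF this(1) m(3)] P Peq m(1)
      show "(P', u') \<in> ?f ` (NC2_mton n \<times> {1..2*n+1})"
        by (intro image_eqI[of _ _ "((P, u), m)"]) (auto simp: NC2_mton_def u_def)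
    qed
  qed
qed

section \<open>Averaging over the gaps\<close>

lemma expectation_mton_pmf:
  "measure_pmf.expectation (mton_pmf n) f = sum f (NC2_mton n) / card (NC2_mton n)"
  unfolding mton_pmf_def by (rule integral_pmf_of_set[OF NC2_mton_nonempty finite_NC2_mton])

text \<open>The bijection turns a sum over the larger set into a double sum, and its cardinality
  grows by the number of gaps. Two statistics \<open>f\<close> and \<open>g\<close> appear because
  \<open>Int_count\<close> depends on the size.\<close>

lemma expectation_mton_pmf_Suc:
  assumes "\<And>P u. (P, u) \<in> NC2_mton n \<Longrightarrow>
    (\<Sum>m=1..2*n+1. f (insert_pair m P, insert_ordering n m P u)) = c * g (P, u) + d"
  shows "measure_pmf.expectation (mton_pmf (Suc n)) f =
    (c * measure_pmf.expectation (mton_pmf n) g + d) / (2 * real n + 1)"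
proof -
  let ?N = "card (NC2_mton n)"
  have "card (NC2_mton (Suc n)) = ?N * (2 * n + 1)"
    using bij_betw_same_card[OF bij_betw_insert_pair[of n]]
    by (simp only: card_cartesian_product card_atLeastAtMost) simp
  then have card: "real (card (NC2_mton (Suc n))) = ?N * (2 * real n + 1)"
    by (simp add: algebra_simps)
  have "sum f (NC2_mton (Suc n)) =
      (\<Sum>((P, u), m)\<in>NC2_mton n \<times> {1..2*n+1}. f (insert_pair m P, insert_ordering n m P u))"
    using sum.reindex_bij_betw[OF bij_betw_insert_pair[of n], of f]
    by (simp add: case_prod_unfold)
  also have "\<dots> = (\<Sum>(P, u)\<in>NC2_mton n. \<Sum>m=1..2*n+1. f (insert_pair m P, insert_ordering n m P u))"
    by (simp add: sum.cartesian_product case_prod_unfold del: sum.cl_ivl_Suc)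
  also have "\<dots> = (\<Sum>x\<in>NC2_mton n. c * g x + d)"
    by (intro sum.cong refl) (clarify, rule assms)
  also have "\<dots> = c * sum g (NC2_mton n) + d * ?N"
    by (simp add: sum.distrib sum_distrib_left)
  finally have s: "sum f (NC2_mton (Suc n)) = c * sum g (NC2_mton n) + d * ?N" .
  have "real ?N \<noteq> 0"
    using NC2_mton_nonempty finite_NC2_mton by simp
  then show ?thesis
    unfolding expectation_mton_pmf s card by (simp add: field_simps)
qed

section \<open>Interval pairs\<close>

lemma interval_pair_iff:
  assumes "P \<in> NC2 (2 * n)" "V \<in> P"
  shows "interval_pair n V \<longleftrightarrow> (\<exists>k. V = {k, Suc k})"
proof
  assume "\<exists>k. V = {k, Suc k}"
  then obtain k where "V = {k, Suc k}" ..
  moreover from this have "1 \<le> k" "k \<le> 2 * n - 1"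
    using NC2_block(5)[OF assms] by auto
  ultimately show "interval_pair n V"
    by (auto simp: interval_pair_def)
qed (auto simp: interval_pair_def)

text \<open>Gap \<open>m\<close> separates only the neighbours \<open>m - 1\<close> and
  \<open>m\<close>, so \<open>{m - 1, m}\<close> is the only interval pair that can be lost. At the
  two extreme gaps this set is not a block and nothing is subtracted.\<close>

lemma card_interval_pairs_insert_pair:
  assumes P: "P \<in> NC2 (2 * n)" and m: "m \<in> {1..2*n+1}"
  shows "real (card {V \<in> insert_pair m P. interval_pair (Suc n) V}) =
    1 + real (card {V \<in> P. interval_pair n V})
      - real (card {V \<in> P. interval_pair n V \<and> V = {m - 1, m}})"
proof -
  have P': "insert_pair m P \<in> NC2 (2 * Suc n)"
    using NC2_insert_pair[OF m] P by simp
  have skip: "interval_pair (Suc n) (skip_pair m ` V) \<longleftrightarrow> interval_pair n V \<and> V \<noteq> {m - 1, m}"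
    if V: "V \<in> P" for V
  proof -
    have V': "skip_pair m ` V \<in> insert_pair m P"
      using V by (simp add: insert_pair_def)
    obtain a b where ab: "V = {a, b}" "a < b"
      using NC2_block(3,4)[OF P V] by metis
    have iff: "(\<exists>k. {x, y} = {k, Suc k}) \<longleftrightarrow> y = Suc x" if "x < y" for x y :: nat
      using that by (metis Suc_n_not_le_n doubleton_eq_iff less_imp_le)
    have "interval_pair n V \<longleftrightarrow> b = Suc a"
      unfolding interval_pair_iff[OF P V] using iff ab by simp
    moreover have "interval_pair (Suc n) (skip_pair m ` V) \<longleftrightarrow> skip_pair m b = Suc (skip_pair m a)"
      unfolding interval_pair_iff[OF P' V'] using iff ab by simp
    moreover have "V = {m - 1, m} \<longleftrightarrow> a = m - 1 \<and> b = m"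
      using ab m by (auto simp: doubleton_eq_iff)
    ultimately show ?thesis
      using ab(2) m by (auto simp: skip_pair_def)
  qed
  let ?I = "{V \<in> P. interval_pair n V}" and ?J = "{V \<in> P. interval_pair n V \<and> V = {m - 1, m}}"
  have "interval_pair (Suc n) {m, Suc m}"
    using m by (auto simp: interval_pair_def)
  then have "{V \<in> insert_pair m P. interval_pair (Suc n) V} =
      insert {m, Suc m} ((`) (skip_pair m) ` (?I - ?J))"
    using skip by (auto simp: insert_pair_def)
  moreover have "card \<dots> = Suc (card (?I - ?J))"
    using NC2_finite[OF P] by (subst card_insert_disjoint) (auto simp: card_image inj_on_def)
  moreover have "real (card (?I - ?J)) = real (card ?I) - real (card ?J)"
    using NC2_finite[OF P]
    by (subst card_Diff_subset) (auto intro!: of_nat_diff card_mono)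
  ultimately show ?thesis by simp
qed

text \<open>Each old interval pair is split by exactly one gap and survives at the other
  \<open>2 * n\<close>; each gap contributes one new interval pair.\<close>

lemma sum_Int_count_insert_pair:
  assumes "(P, u) \<in> NC2_mton n"
  shows "(\<Sum>m=1..2*n+1. Int_count (Suc n) (insert_pair m P, insert_ordering n m P u))
    = 2 * real n * Int_count n (P, u) + (2 * real n + 1)"
proof -
  have P: "P \<in> NC2 (2 * n)" using assms by (simp add: NC2_mton_def)
  let ?I = "{V \<in> P. interval_pair n V}"
  have fin: "finite ?I" using NC2_finite[OF P] by simp
  have one: "card {m \<in> {1..2*n+1}. V = {m - 1, m}} = 1" if V: "V \<in> ?I" for V
  proof -
    obtain k where k: "1 \<le> k" "k \<le> 2 * n - 1" "V = {k, Suc k}"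
      using V by (auto simp: interval_pair_def)
    then have "{m \<in> {1..2*n+1}. V = {m - 1, m}} = {Suc k}"
      by (auto simp: doubleton_eq_iff)
    then show ?thesis by simp
  qed
  \<comment> \<open>Double counting of the incidences between gaps and the interval pairs that they
    split.\<close>
  have "(\<Sum>m=1..2*n+1. card {V \<in> ?I. V = {m - 1, m}}) =
      (\<Sum>V\<in>?I. card {m \<in> {1..2*n+1}. V = {m - 1, m}})"
    by (rule sum_multicount_gen) (use fin in auto)
  also have "\<dots> = card ?I" using one by simp
  finally have s: "(\<Sum>m=1..2*n+1. real (card {V \<in> P. interval_pair n V \<and> V = {m - 1, m}})) = card ?I"
    unfolding of_nat_sum[symmetric] by (simp only: mem_Collect_eq conj_assoc)
  have "(\<Sum>m=1..2*n+1. Int_count (Suc n) (insert_pair m P, insert_ordering n m P u)) =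
      (\<Sum>m=1..2*n+1. 1 + real (card ?I)
        - real (card {V \<in> P. interval_pair n V \<and> V = {m - 1, m}}))"
    unfolding Int_count_def prod.case
    by (intro sum.cong refl card_interval_pairs_insert_pair[OF P])
  also have "\<dots> = (2 * real n + 1) * (1 + real (card ?I)) - real (card ?I)"
    unfolding sum_subtractf s by simp
  finally show ?thesis
    by (simp add: Int_count_def algebra_simps del: sum.cl_ivl_Suc)
qed

section \<open>Outer pairs\<close>

text \<open>The block through the point before an uncovered gap must end there, and any block around
  it would cover the gap. Conversely, a block covering the gap right after an outer pair would
  enclose or cross that pair.\<close>

lemma uncovered_gaps:
  assumes P: "P \<in> NC2 (2 * n)"
  shows "{m \<in> {1..2*n+1}. \<forall>W\<in>P. \<not> (Min W < m \<and> m \<le> Max W)} =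
    insert 1 ((\<lambda>V. Suc (Max V)) ` {V \<in> P. outer_pair P V})" (is "?L = insert 1 ?R")
proof
  note blk = NC2_block[OF P]
  show "insert 1 ?R \<subseteq> ?L"
  proof
    fix m assume "m \<in> insert 1 ?R"
    then consider "m = 1" | V where "V \<in> P" "outer_pair P V" "m = Suc (Max V)" by blast
    then show "m \<in> ?L"
    proof cases
      case 1
      then show ?thesis using blk(1,2,5) Min_in by fastforce
    next
      case 2
      have "\<not> (Min W < m \<and> m \<le> Max W)" if W: "W \<in> P" for W
      proof
        assume *: "Min W < m \<and> m \<le> Max W"
        then have VW: "V \<noteq> W" using 2 by auto
        have "Min W \<noteq> Max V" "Min V \<noteq> Min W"
          using NC2_disjoint[OF P 2(1) W] VW blk(1,2)[OF 2(1)] blk(1,2)[OF W]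
          by (metis Max_in Min_in)+
        \<comment> \<open>If \<open>W\<close> started inside \<open>V\<close> it would cross
          \<open>V\<close>; so it starts before \<open>V\<close> and encloses it.\<close>
        with * 2(3) have "nested_inside V W"
          using NC2_not_crossing[OF P 2(1) W VW] unfolding nested_inside_def by linarith
        with 2(2) W show False by (auto simp: outer_pair_def)
      qed
      moreover have "m \<in> {1..2*n+1}"
        using 2 blk(1,2,5)[OF 2(1)] Max_in by fastforce
      ultimately show ?thesis by blast
    qed
  qed
  show "?L \<subseteq> insert 1 ?R"
  proof
    fix m assume m: "m \<in> ?L"
    show "m \<in> insert 1 ?R"
    proof (cases "m = 1")
      case False
      with m have "m - 1 \<in> {1..2*n}" by auto
      then obtain V where V: "V \<in> P" "m - 1 \<in> V"
        using P unfolding NC2_def partition_on_def by blast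
      have "V = {Min V, Max V}" by (rule blk(3)[OF V(1)])
      with V(2) have "m - 1 = Min V \<or> m - 1 = Max V" by blast
      moreover have "\<not> (Min V < m \<and> m \<le> Max V)" using m V(1) by blast
      ultimately have eq: "m = Suc (Max V)"
        using False m blk(4)[OF V(1)] by auto
      have "outer_pair P V"
        unfolding outer_pair_def
      proof
        assume "\<exists>W\<in>P. nested_inside V W"
        then obtain W where "W \<in> P" "nested_inside V W" by blast
        with m eq blk(4)[OF V(1)] show False by (auto simp: nested_inside_def)
      qed
      with V eq show ?thesis by blast
    qed simp
  qed
qed

text \<open>No old pair is nested inside the new one, so old pairs keep their status; the new pair
  is enclosed exactly by the blocks that cover its gap.\<close>

lemma outer_pairs_insert_pair:
  assumes P: "P \<in> NC2 k"
  shows "{V \<in> insert_pair m P. outer_pair (insert_pair m P) V} =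
    (`) (skip_pair m) ` {V \<in> P. outer_pair P V} \<union>
    (if \<forall>W\<in>P. \<not> (Min W < m \<and> m \<le> Max W) then {{m, Suc m}} else {})"
proof -
  have "\<not> nested_inside {m, Suc m} {m, Suc m}" by (simp add: nested_inside_def)
  then have "outer_pair (insert_pair m P) {m, Suc m} \<longleftrightarrow> (\<forall>W\<in>P. \<not> (Min W < m \<and> m \<le> Max W))"
    using nested_inside_inserted(1)[OF P] by (auto simp: outer_pair_def insert_pair_def)
  moreover have "outer_pair (insert_pair m P) (skip_pair m ` V) \<longleftrightarrow> outer_pair P V" if "V \<in> P" for V
    using nested_inside_inserted(2)[OF P that] nested_inside_skip_pair[OF P that]
    by (auto simp: outer_pair_def insert_pair_def)
  ultimately show ?thesis
    by (auto simp: insert_pair_def)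
qed

text \<open>Every one of the \<open>2 * n + 1\<close> gaps keeps the old outer pairs. The uncovered
  gaps, one more than there are outer pairs, each add one; hence the coefficient
  \<open>2 * n + 2\<close> and the constant 1.\<close>

lemma sum_Out_count_insert_pair:
  assumes "(P, u) \<in> NC2_mton n"
  shows "(\<Sum>m=1..2*n+1. Out_count (insert_pair m P, insert_ordering n m P u))
    = (2 * real n + 2) * Out_count (P, u) + 1"
proof -
  have P: "P \<in> NC2 (2 * n)" using assms by (simp add: NC2_mton_def)
  let ?O = "{V \<in> P. outer_pair P V}"
  let ?free = "\<lambda>m. \<forall>W\<in>P. \<not> (Min W < m \<and> m \<le> Max W)"
  have fin: "finite ?O" using NC2_finite[OF P] by simp
  have "card {V \<in> insert_pair m P. outer_pair (insert_pair m P) V} =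
      card ?O + (if ?free m then 1 else 0)" for m
    using fin unfolding outer_pairs_insert_pair[OF P]
    by (subst card_Un_disjoint) (auto simp: card_image inj_on_def)
  then have "(\<Sum>m=1..2*n+1. card {V \<in> insert_pair m P. outer_pair (insert_pair m P) V}) =
      (2 * n + 1) * card ?O + card {m \<in> {1..2*n+1}. ?free m}"
    by (simp add: sum.distrib sum.inter_filter[symmetric] del: sum.cl_ivl_Suc)
  also have "card {m \<in> {1..2*n+1}. ?free m} = Suc (card ?O)"
  proof -
    have "inj_on (\<lambda>V. Suc (Max V)) ?O"
      using NC2_disjoint[OF P] NC2_block(1,2)[OF P] by (auto intro!: inj_onI) (metis Max_in)+
    moreover have "Suc (Max V) \<noteq> 1" if "V \<in> ?O" for V
      using NC2_block(4)[OF P, of V] that by auto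
    ultimately show ?thesis
      unfolding uncovered_gaps[OF P] using fin by (subst card_insert_disjoint) (force simp: card_image)+
  qed
  finally show ?thesis
    by (simp add: Out_count_def algebra_simps flip: of_nat_sum del: sum.cl_ivl_Suc)
qed

section \<open>Closed forms of the expectations\<close>

text \<open>The induction starts at size 1, as at size 0 the expectation is 0 and not 1/3. In the
  base case the factor \<open>2 * real 0\<close> removes the earlier expectation.\<close>

lemma expectation_Int_count_Suc:
  "measure_pmf.expectation (mton_pmf (Suc n)) (Int_count (Suc n)) = (2 * real (Suc n) + 1) / 3"
proof (induction n)
  case 0
  show ?case
    by (subst expectation_mton_pmf_Suc[OF sum_Int_count_insert_pair]) simp_all
next
  case (Suc n)
  show ?case
    by (subst expectation_mton_pmf_Suc[OF sum_Int_count_insert_pair])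
       (simp_all only: Suc, simp add: field_simps)
qed

text \<open>For \<open>n = 0\<close> truncated subtraction gives \<open>double_fact 0 = 1\<close>,
  which agrees with the convention (-1)!! = 1.\<close>

lemma double_fact_odd_Suc:
  "double_fact (2 * Suc n - 1) = (2 * n + 1) * double_fact (2 * n - 1)"
  by (cases n) auto

lemma double_fact_ratio_Suc:
  "2 ^ Suc n * fact (Suc n) / real (double_fact (2 * Suc n - 1)) =
    (2 * real n + 2) / (2 * real n + 1) * (2 ^ n * fact n / real (double_fact (2 * n - 1)))"
  unfolding double_fact_odd_Suc by (simp add: algebra_simps)

lemma NC2_0: "NC2 0 = {{}}"
  by (auto simp: NC2_def partition_on_def non_crossing_def)

text \<open>Adding 1 to the expectation makes its recursion homogeneous, with factor
  \<open>(2 * n + 2) / (2 * n + 1)\<close>, the same as in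
  \<open>double_fact_ratio_Suc\<close>.\<close>

lemma expectation_Out_count:
  "measure_pmf.expectation (mton_pmf n) Out_count
     = 2 ^ n * fact n / real (double_fact (2 * n - 1)) - 1"
proof (induction n)
  case 0
  have "sum Out_count (NC2_mton 0) = 0"
    by (rule sum.neutral) (auto simp: NC2_mton_def NC2_0 Out_count_def)
  then show ?case by (simp add: expectation_mton_pmf)
next
  case (Suc n)
  show ?case
    by (subst expectation_mton_pmf_Suc[OF sum_Out_count_insert_pair])
       (simp_all only: Suc double_fact_ratio_Suc, simp add: divide_simps, simp add: algebra_simps)
qed

section \<open>Asymptotics from the Wallis product\<close>

text \<open>Since 4(n+1)^2 - 1 = (2n+1)(2n+3), each step multiplies both sides by
  ((2n+2)/(2n+1))^2.\<close>

lemma double_fact_ratio_wallis: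
  "(2 ^ n * fact n / real (double_fact (2 * n - 1)))\<^sup>2 =
    (2 * real n + 1) * (\<Prod>k=1..n. (4*real k^2) / (4*real k^2 - 1))"
proof (induction n)
  case (Suc n)
  let ?p = "\<Prod>k=1..n. (4*real k^2) / (4*real k^2 - 1)"
  have "4 * (real (Suc n))\<^sup>2 - 1 = (2 * real n + 1) * (2 * real n + 3)"
    by (simp add: power2_eq_square algebra_simps)
  then have "(\<Prod>k=1..Suc n. (4*real k^2) / (4*real k^2 - 1)) =
      ?p * ((2 * real n + 2)\<^sup>2 / ((2 * real n + 1) * (2 * real n + 3)))"
    by (simp add: power2_eq_square algebra_simps)
  moreover have "((2 * real n + 2) / (2 * real n + 1))\<^sup>2 * ((2 * real n + 1) * ?p) =
      (2 * real (Suc n) + 1) * (?p * ((2 * real n + 2)\<^sup>2 / ((2 * real n + 1) * (2 * real n + 3))))"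
    by (simp add: divide_simps power2_eq_square)
  ultimately show ?case
    unfolding double_fact_ratio_Suc power_mult_distrib[of "_ / _"] Suc by simp
qed simp

lemma double_fact_ratio_asymp_equiv:
  "(\<lambda>n. 2 ^ n * fact n / real (double_fact (2 * n - 1))) \<sim>[at_top] (\<lambda>n. sqrt (pi * real n))"
proof -
  define a :: "nat \<Rightarrow> real" where "a = (\<lambda>n. 2 ^ n * fact n / real (double_fact (2 * n - 1)))"
  have "(\<lambda>n. (2 * real n + 1) / (pi * real n)) \<longlonglongrightarrow> 2 / pi"
    by (real_asymp simp: divide_inverse)
  \<comment> \<open>The Wallis product tends to \<open>pi / 2\<close>, which cancels the limit
    \<open>2 / pi\<close>.\<close>
  from tendsto_real_sqrt[OF tendsto_mult[OF this wallis]]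
  have "(\<lambda>n. sqrt ((a n)\<^sup>2 / (pi * real n))) \<longlonglongrightarrow> 1"
    unfolding a_def double_fact_ratio_wallis by simp
  moreover have "a n \<ge> 0" for n by (simp add: a_def)
  ultimately have "(\<lambda>n. a n / sqrt (pi * real n)) \<longlonglongrightarrow> 1"
    by (simp add: real_sqrt_divide)
  then show ?thesis
    unfolding a_def by (rule asymp_equivI')
qed

theorem theorem1p10:
  shows "(\<forall>n\<ge>1. measure_pmf.expectation (mton_pmf n) (Int_count n) = (2 * real n + 1) / 3)
    \<and> (\<forall>n\<ge>1. measure_pmf.expectation (mton_pmf n) Out_count
          = 2 ^ n * fact n / real (double_fact (2 * n - 1)) - 1)
    \<and> (\<lambda>n. measure_pmf.expectation (mton_pmf n) Out_count)
        \<sim>[at_top] (\<lambda>n. sqrt (pi * real n))"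
proof (intro conjI allI impI)
  fix n :: nat assume "n \<ge> 1"
  then show "measure_pmf.expectation (mton_pmf n) (Int_count n) = (2 * real n + 1) / 3"
    using expectation_Int_count_Suc[of "n - 1"] by simp
next
  fix n :: nat
  show "measure_pmf.expectation (mton_pmf n) Out_count
      = 2 ^ n * fact n / real (double_fact (2 * n - 1)) - 1"
    by (rule expectation_Out_count)
next
  \<comment> \<open>The summand -1 of the closed form is negligible against the square root.\<close>
  have "(\<lambda>n. - 1 :: real) \<in> o(\<lambda>n. sqrt (pi * real n))"
    by real_asymp
  from asymp_equiv_add_right[OF this] double_fact_ratio_asymp_equiv
  show "(\<lambda>n. measure_pmf.expectation (mton_pmf n) Out_count) \<sim>[at_top] (\<lambda>n. sqrt (pi * real n))"
    by (simp add: expectation_Out_count)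
qed

end
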